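(* There exists no topologically transitive piecewise-linear vector field on $\mathbb{S}^2$ having two zones separated by a circle.
   Context: $\mathbb{S}^2\subset\mathbb{R}^3$ is the unit sphere centered at the origin. A circle on $\mathbb{S}^2$ is the (non-degenerate) intersection of $\mathbb{S}^2$ with a plane; it may or may not be a great circle. **Piecewise-smooth vector field (PSVF).** A PSVF is a triple $(M,\Sigma,Z)$, usually denoted just by $Z$, where: (i) $M$ is a manifold (here $M=\mathbb{S}^2$); (ii) $\Sigma=\Sigma_1\sqcup\cdots\sqcup\Sigma_n$ (the switching manifold) is a finite union of pairwise disjoint simple smooth curves splitting $M$ into $n+1$ connected regions $R_1,\dots,R_{n+1}$ (the zones), with $\Sigma_i=\gamma_i^{-1}(0)$ for smooth functions $\gamma_i:M\to\mathbb{R}$ having $0$ as a regular value; (iii) $Z=(X_1,\dots,X_{n+1})$ where each $X_k$ is a vector field of class $C^r$ on $M$, restricted to the closure of $R_k$. Two zones separated by a circle means $n=1$ and $\Sigma=\Sigma_1$ is a circle. **Piecewise-linear.** A PSVF on $\mathbb{S}^2$ is piecewise-linear if each $X_k$ is the restriction of a linear vector field $X_k(\mathbf{x})=A_k\mathbf{x}$ of $\mathbb{R}^3$ that is tangent to $\mathbb{S}^2$. **Regions of $\Sigma$.** Let $\Sigma_i$ be the common boundary of two regions $R_a$ and $R_b$, with $\nabla\gamma_i$ pointing into $R_a$ along $\Sigma_i$. Put $X_k.\gamma_i(p)=\langle X_k(p),\nabla\gamma_i(p)\rangle$. A point $p\in\Sigma_i$ is: a crossing point if $(X_a.\gamma_i(p))(X_b.\gamma_i(p))>0$;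 an escaping point if $X_a.\gamma_i(p)>0$ and $X_b.\gamma_i(p)<0$; a sliding point if $X_a.\gamma_i(p)<0$ and $X_b.\gamma_i(p)>0$; a tangency point if $X_a.\gamma_i(p)=0$ or $X_b.\gamma_i(p)=0$. The sets of all such points over all $i$ are denoted $\Sigma^c,\Sigma^e,\Sigma^s,\Sigma^t$. **Sliding (Filippov) vector field.** On $\Sigma^s\cup\Sigma^e$, $Z^\Sigma(p)$ is the unique convex combination of $X_a(p)$ and $X_b(p)$ tangent to $\Sigma_i$, i.e. $Z^\Sigma(p)=\frac{X_b.\gamma_i(p)\,X_a(p)-X_a.\gamma_i(p)\,X_b(p)}{X_b.\gamma_i(p)-X_a.\gamma_i(p)}$. If $p\in\Sigma^t$ and $\lim_{q\to p}Z^\Sigma(q)=L\neq0$ ($q\in\Sigma^s\cup\Sigma^e$), then $Z^\Sigma$ is extended to $p$ by $Z^\Sigma(p)=L$. **Trajectories.** A global trajectory of $Z$ is a continuous curve obtained by time-oriented concatenation of trajectories of the fields $X_k$ (each inside the closure of $R_k$) and/or of $Z^\Sigma$ (inside $\Sigma$). A Filippov trajectory (or orbit) is a global trajectory that is maximal, i.e. cannot be extended by any such concatenation. Trajectories through a given point need not be unique. **Topological transitivity.** $Z$ is (topologically) transitive if for any two non-empty open sets $U,V\subset M$ there is a Filippov trajectory connecting them, i.e. one visiting both $U$ and $V$. *)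

theory Defs
  imports "HOL-Analysis.Analysis"
begin

type_synonym vec3 = "real ^ 3"

abbreviation S2 :: "vec3 set" where
  "S2 \<equiv> sphere 0 1"

text \<open>Non-degenerate: the plane section is neither empty nor a single point.\<close>

definition is_circle :: "vec3 set \<Rightarrow> bool" where
  "is_circle C \<longleftrightarrow>
     (\<exists>n c. n \<noteq> 0 \<and> C = S2 \<inter> {x. n \<bullet> x = c}) \<and> \<not> (\<exists>p. C \<subseteq> {p})"

primrec Ck_on :: "nat \<Rightarrow> vec3 set \<Rightarrow> (vec3 \<Rightarrow> 'b::real_normed_vector) \<Rightarrow> bool" where
  "Ck_on 0 U f \<longleftrightarrow> continuous_on U f"
| "Ck_on (Suc k) U f \<longleftrightarrow>
     f differentiable_on U \<and> (\<forall>v. Ck_on k U (\<lambda>x. frechet_derivative f (at x) v))"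

definition gradient :: "(vec3 \<Rightarrow> real) \<Rightarrow> vec3 \<Rightarrow> vec3" where
  "gradient f p = (\<Sum>b\<in>Basis. frechet_derivative f (at p) b *\<^sub>R b)"

text \<open>The Riemannian gradient on the sphere of the restriction of \<open>f\<close>: the orthogonal
  projection of the ambient gradient to the tangent plane at \<open>p\<close>. It depends only on the
  values of \<open>f\<close> on the sphere.\<close>

definition surface_gradient :: "(vec3 \<Rightarrow> real) \<Rightarrow> vec3 \<Rightarrow> vec3" where
  "surface_gradient f p = gradient f p - (gradient f p \<bullet> p) *\<^sub>R p"

definition tangent_field :: "nat \<Rightarrow> (vec3 \<Rightarrow> vec3) \<Rightarrow> bool" where
  "tangent_field r X \<longleftrightarrow>
     (\<exists>U F. open U \<and> S2 \<subseteq> U \<and> Ck_on r U F \<and> (\<forall>p\<in>S2. F p = X p)) \<and>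
     (\<forall>p\<in>S2. X p \<bullet> p = 0)"

text \<open>Piecewise-smooth vector fields on the sphere with one switching curve. The curve is the
  zero set of \<open>switch_fun\<close>, which is given as a function near the sphere (every smooth function
  on the sphere has a smooth extension). Since 0 is a regular value, the two zones are the sets
  where it is positive, into which the gradient points, and negative.\<close>

record psvf =
  switch_fun :: "vec3 \<Rightarrow> real"
  field_pos :: "vec3 \<Rightarrow> vec3"
  field_neg :: "vec3 \<Rightarrow> vec3"

definition switching :: "psvf \<Rightarrow> vec3 set" where
  "switching Z = {p \<in> S2. switch_fun Z p = 0}"

definition zone_pos :: "psvf \<Rightarrow> vec3 set" where
  "zone_pos Z = {p \<in> S2. switch_fun Z p > 0}"

definition zone_neg :: "psvf \<Rightarrow> vec3 set" where
  "zone_neg Z = {p \<in> S2. switch_fun Z p < 0}"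

text \<open>A non-empty connected regular level set on the sphere is a simple closed smooth curve.\<close>

definition is_psvf :: "nat \<Rightarrow> psvf \<Rightarrow> bool" where
  "is_psvf r Z \<longleftrightarrow>
     (\<exists>U. open U \<and> S2 \<subseteq> U \<and> (\<forall>k. Ck_on k U (switch_fun Z))) \<and>
     (\<forall>p\<in>switching Z. surface_gradient (switch_fun Z) p \<noteq> 0) \<and>
     switching Z \<noteq> {} \<and> connected (switching Z) \<and>
     connected (zone_pos Z) \<and> connected (zone_neg Z) \<and>
     tangent_field r (field_pos Z) \<and> tangent_field r (field_neg Z)"

definition linear_on_zone :: "(vec3 \<Rightarrow> vec3) \<Rightarrow> vec3 set \<Rightarrow> bool" where
  "linear_on_zone X R \<longleftrightarrow>
     (\<exists>A :: real ^ 3 ^ 3. (\<forall>p\<in>S2. (A *v p) \<bullet> p = 0) \<and> (\<forall>p\<in>closure R. X p = A *v p))"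

definition piecewise_linear :: "psvf \<Rightarrow> bool" where
  "piecewise_linear Z \<longleftrightarrow>
     linear_on_zone (field_pos Z) (zone_pos Z) \<and> linear_on_zone (field_neg Z) (zone_neg Z)"

definition lie_pos :: "psvf \<Rightarrow> vec3 \<Rightarrow> real" where
  "lie_pos Z p = field_pos Z p \<bullet> surface_gradient (switch_fun Z) p"

definition lie_neg :: "psvf \<Rightarrow> vec3 \<Rightarrow> real" where
  "lie_neg Z p = field_neg Z p \<bullet> surface_gradient (switch_fun Z) p"

definition escaping :: "psvf \<Rightarrow> vec3 set" where
  "escaping Z = {p \<in> switching Z. lie_pos Z p > 0 \<and> lie_neg Z p < 0}"

definition sliding :: "psvf \<Rightarrow> vec3 set" where
  "sliding Z = {p \<in> switching Z. lie_pos Z p < 0 \<and> lie_neg Z p > 0}"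

definition tangency :: "psvf \<Rightarrow> vec3 set" where
  "tangency Z = {p \<in> switching Z. lie_pos Z p = 0 \<or> lie_neg Z p = 0}"

definition convex_field :: "psvf \<Rightarrow> vec3 \<Rightarrow> vec3" where
  "convex_field Z p =
     (lie_neg Z p *\<^sub>R field_pos Z p - lie_pos Z p *\<^sub>R field_neg Z p) /\<^sub>R (lie_neg Z p - lie_pos Z p)"

text \<open>\<open>sliding_velocity Z p v\<close>: the sliding vector field, extended to tangency points where it
  has a non-zero limit, is defined at \<open>p\<close> and has the value \<open>v\<close> there. Without the
  condition \<open>islimpt\<close> every \<open>v\<close> would count as a limit at a point isolated from the
  sliding and escaping regions.\<close>

definition sliding_velocity :: "psvf \<Rightarrow> vec3 \<Rightarrow> vec3 \<Rightarrow> bool" where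
  "sliding_velocity Z p v \<longleftrightarrow>
     p \<in> sliding Z \<union> escaping Z \<and> v = convex_field Z p \<or>
     p \<in> tangency Z \<and> p islimpt (sliding Z \<union> escaping Z) \<and>
       (convex_field Z \<longlongrightarrow> v) (at p within (sliding Z \<union> escaping Z)) \<and> v \<noteq> 0"

definition field_arc :: "(vec3 \<Rightarrow> vec3) \<Rightarrow> vec3 set \<Rightarrow> real set \<Rightarrow> (real \<Rightarrow> vec3) \<Rightarrow> bool" where
  "field_arc X K J \<phi> \<longleftrightarrow>
     (\<forall>t\<in>J. \<phi> t \<in> K \<and> (\<phi> has_vector_derivative X (\<phi> t)) (at t within J))"

definition sliding_arc :: "psvf \<Rightarrow> real set \<Rightarrow> (real \<Rightarrow> vec3) \<Rightarrow> bool" where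
  "sliding_arc Z J \<phi> \<longleftrightarrow>
     (\<forall>t\<in>J. \<exists>v. sliding_velocity Z (\<phi> t) v \<and> (\<phi> has_vector_derivative v) (at t within J))"

text \<open>\<open>P\<close> is the set of times at which pieces are joined. It may be infinite, but only finitely
  many joints lie in a compact part of \<open>I\<close>, so the pieces are indexed by consecutive integers.
  The equations are imposed on the open intervals between joints, so that a piece may end at a
  point where the sliding vector field is undefined. The kind of a piece does not change
  between consecutive joints, because each kind is inherited by subintervals.\<close>

definition global_trajectory :: "psvf \<Rightarrow> real set \<Rightarrow> (real \<Rightarrow> vec3) \<Rightarrow> bool" where
  "global_trajectory Z I \<phi> \<longleftrightarrow>
     is_interval I \<and> interior I \<noteq> {} \<and> continuous_on I \<phi> \<and>
     (\<exists>P. (\<forall>s\<in>I. \<forall>t\<in>I. finite (P \<inter> {s..t})) \<and>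
          (\<forall>s\<in>I. \<forall>t\<in>I. s < t \<and> P \<inter> {s<..<t} = {} \<longrightarrow>
             field_arc (field_pos Z) (closure (zone_pos Z)) {s<..<t} \<phi> \<or>
             field_arc (field_neg Z) (closure (zone_neg Z)) {s<..<t} \<phi> \<or>
             sliding_arc Z {s<..<t} \<phi>))"

definition filippov_trajectory :: "psvf \<Rightarrow> real set \<Rightarrow> (real \<Rightarrow> vec3) \<Rightarrow> bool" where
  "filippov_trajectory Z I \<phi> \<longleftrightarrow>
     global_trajectory Z I \<phi> \<and>
     \<not> (\<exists>J \<psi>. global_trajectory Z J \<psi> \<and> I \<subset> J \<and> (\<forall>t\<in>I. \<psi> t = \<phi> t))"

definition topologically_transitive :: "psvf \<Rightarrow> bool" where
  "topologically_transitive Z \<longleftrightarrow>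
     (\<forall>U V. openin (top_of_set S2) U \<and> U \<noteq> {} \<and> openin (top_of_set S2) V \<and> V \<noteq> {} \<longrightarrow>
        (\<exists>I \<phi>. filippov_trajectory Z I \<phi> \<and> (\<exists>s\<in>I. \<phi> s \<in> U) \<and> (\<exists>t\<in>I. \<phi> t \<in> V)))"

end

theory Submission
  imports Defs
begin

text \<open>Each field is a rotation \<open>p \<mapsto> a \<times> p\<close>. If a zone contains a pole of its own rotation, small
  circles around the pole are invariant and disks bounded by them cannot be left. Since the poles
  of a rotation are antipodal, neither zone contains one only if the switching circle is a great
  circle and both axes lie in its plane. Then every orbit in a zone is a half circle
  perpendicular to the axis. If the axes have the same direction, both fields have the first
  integral \<open>a \<bullet> p\<close> and nothing slides. Otherwise the sliding region contains an arc, and the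
  sliding field vanishes, because at the switching circle both fields are parallel to its axis.
  So every trajectory that arrives at this arc stays where it lands, and two such landing orbits
  are never visited by a common trajectory.\<close>

unbundle cross3_syntax

section \<open>Trajectories between two joints\<close>

text \<open>The equation is imposed only between the end points, continuity also at them: a piece
  may end where it obeys no equation, and its end values are limits of inner ones.\<close>

definition joint_free_arc :: "psvf \<Rightarrow> real \<Rightarrow> real \<Rightarrow> (real \<Rightarrow> vec3) \<Rightarrow> bool" where
  "joint_free_arc Z u v \<phi> \<longleftrightarrow> u < v \<and> continuous_on {u..v} \<phi> \<and>
     (field_arc (field_pos Z) (closure (zone_pos Z)) {u<..<v} \<phi> \<or>
      field_arc (field_neg Z) (closure (zone_neg Z)) {u<..<v} \<phi> \<or>
      sliding_arc Z {u<..<v} \<phi>)"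

lemma joint_free_arc_cases [consumes 1, case_names pos neg sliding]:
  assumes "joint_free_arc Z u v \<phi>"
  obtains "u < v" "continuous_on {u..v} \<phi>" "field_arc (field_pos Z) (closure (zone_pos Z)) {u<..<v} \<phi>"
  | "u < v" "continuous_on {u..v} \<phi>" "field_arc (field_neg Z) (closure (zone_neg Z)) {u<..<v} \<phi>"
  | "u < v" "continuous_on {u..v} \<phi>" "sliding_arc Z {u<..<v} \<phi>"
  using assms unfolding joint_free_arc_def by blast

text \<open>Only finitely many joints lie between two times, so a property handed on by every piece
  is handed on along the whole stretch, forward in time.\<close>

lemma global_trajectory_induct:
  assumes gt: "global_trajectory Z I \<phi>" and I: "s \<in> I" "t \<in> I" and st: "s \<le> t"
    and Q: "Q (\<phi> s)"
    and step: "\<And>u v. joint_free_arc Z u v \<phi> \<Longrightarrow> Q (\<phi> u) \<Longrightarrow> Q (\<phi> v)"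
  shows "Q (\<phi> t)"
proof -
  have int: "is_interval I" and cont: "continuous_on I \<phi>"
    using gt unfolding global_trajectory_def by simp_all
  from gt[unfolded global_trajectory_def] obtain P
    where "\<forall>s\<in>I. \<forall>t\<in>I. finite (P \<inter> {s..t})"
    and P: "\<forall>s\<in>I. \<forall>t\<in>I. s < t \<and> P \<inter> {s<..<t} = {} \<longrightarrow>
             field_arc (field_pos Z) (closure (zone_pos Z)) {s<..<t} \<phi> \<or>
             field_arc (field_neg Z) (closure (zone_neg Z)) {s<..<t} \<phi> \<or>
             sliding_arc Z {s<..<t} \<phi>"
    by (elim conjE exE) (rule that; assumption)
  then have fin: "finite (P \<inter> {s..t})" if "s \<in> I" "t \<in> I" for s t
    using that by simp
  have sub: "{u..v} \<subseteq> I" if "u \<in> I" "v \<in> I" for u v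
    using mem_is_interval_1_I[OF int that] by auto
  have fin': "finite (P \<inter> {u<..<v})" if "u \<in> I" "v \<in> I" for u v
    by (rule finite_subset[OF _ fin[OF that]]) auto
  \<comment> \<open>Induction on the number of joints strictly between \<open>s\<close> and the
    fixed \<open>t\<close>; cutting at the first of them leaves fewer.\<close>
  have "s \<in> I \<Longrightarrow> s \<le> t \<Longrightarrow> Q (\<phi> s) \<Longrightarrow> Q (\<phi> t)" if "card (P \<inter> {s<..<t}) = k" for k s
    using that
  proof (induction k arbitrary: s rule: less_induct)
    case (less k)
    consider "s = t" | "s < t" "P \<inter> {s<..<t} = {}" | p where "s < t" "p \<in> P \<inter> {s<..<t}"
      using less.prems(2) by fastforce
    then show ?case
    proof cases
      case 1
      then show ?thesis using less.prems by simp
    next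
      case 2
      have "joint_free_arc Z s t \<phi>"
        unfolding joint_free_arc_def
        using 2 P[rule_format, OF less.prems(1) I(2)] continuous_on_subset[OF cont sub[OF less.prems(1) I(2)]]
        by simp
      then show ?thesis using step less.prems(3) by simp
    next
      case (3 p0)
      define p where "p = Min (P \<inter> {s<..<t})"
      have f: "finite (P \<inter> {s<..<t})" using fin'[OF less.prems(1) I(2)] .
      have "p \<in> P \<inter> {s<..<t}" unfolding p_def by (rule Min_in[OF f]) (use 3 in blast)
      then have p: "p \<in> P" "s < p" "p < t" by auto
      have pI: "p \<in> I" using sub[OF less.prems(1) I(2)] p by auto
      have e: "P \<inter> {s<..<p} = {}"
      proof -
        have False if "q \<in> P" "s < q" "q < p" for q
          using Min_le[OF f, of q] that p unfolding p_def by auto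
        then show ?thesis by auto
      qed
      have "joint_free_arc Z s p \<phi>"
        unfolding joint_free_arc_def
        using p e P[rule_format, OF less.prems(1) pI] continuous_on_subset[OF cont sub[OF less.prems(1) pI]]
        by simp
      then have "Q (\<phi> p)" using step less.prems(3) by simp
      moreover have "card (P \<inter> {p<..<t}) < k"
        unfolding less.prems(4)[symmetric]
      proof (rule psubset_card_mono[OF f])
        have "p \<in> P \<inter> {s<..<t}" "p \<notin> P \<inter> {p<..<t}" "P \<inter> {p<..<t} \<subseteq> P \<inter> {s<..<t}" using p by auto
        then show "P \<inter> {p<..<t} \<subset> P \<inter> {s<..<t}" by blast
      qed
      ultimately show ?thesis
        using less.IH[OF _ pI, of "card (P \<inter> {p<..<t})"] p by auto
    qed
  qed
  from this[OF refl I(1) st Q] show ?thesis .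
qed

text \<open>Each trajectory stays on one level of \<open>H\<close>, so it cannot meet both open sets
  where \<open>H\<close> lies below and above the mean of two distinct values.\<close>

lemma not_transitive_if_first_integral:
  fixes H :: "vec3 \<Rightarrow> real"
  assumes H: "continuous_on S2 H" and pq: "p \<in> S2" "q \<in> S2" "H p \<noteq> H q"
    and step: "\<And>u v \<phi>. joint_free_arc Z u v \<phi> \<Longrightarrow> H (\<phi> v) = H (\<phi> u)"
  shows "\<not> topologically_transitive Z"
proof
  assume T: "topologically_transitive Z"
  define m where "m = (H p + H q) / 2"
  define U where "U = S2 \<inter> H -` {..<m}"
  define V where "V = S2 \<inter> H -` {m<..}"
  have "openin (top_of_set S2) U" "openin (top_of_set S2) V"
    unfolding U_def V_def by (auto intro!: continuous_openin_preimage_gen H)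
  moreover have "U \<noteq> {}" "V \<noteq> {}"
  proof -
    have "p \<in> U \<and> q \<in> V \<or> q \<in> U \<and> p \<in> V"
      using pq unfolding U_def V_def m_def by (auto simp: field_simps)
    then show "U \<noteq> {}" "V \<noteq> {}" by auto
  qed
  ultimately obtain I \<phi> s t where "filippov_trajectory Z I \<phi>"
    and s: "s \<in> I" "\<phi> s \<in> U" and t: "t \<in> I" "\<phi> t \<in> V"
    using T unfolding topologically_transitive_def by meson
  then have gt: "global_trajectory Z I \<phi>" unfolding filippov_trajectory_def by blast
  have const: "H (\<phi> y) = H (\<phi> x)" if "x \<in> I" "y \<in> I" "x \<le> y" for x y
    by (rule global_trajectory_induct[OF gt that(1,2,3), where Q = "\<lambda>p. H p = H (\<phi> x)"])
      (use step in auto)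
  have "H (\<phi> s) = H (\<phi> t)"
    using const[OF s(1) t(1)] const[OF t(1) s(1)] by (cases "s \<le> t") auto
  then show False using s t unfolding U_def V_def by auto
qed

lemma closed_endpoints:
  fixes \<phi> :: "real \<Rightarrow> vec3"
  assumes "u < v" "continuous_on {u..v} \<phi>" "closed K" "\<And>t. u < t \<Longrightarrow> t < v \<Longrightarrow> \<phi> t \<in> K"
    and "t \<in> {u..v}"
  shows "\<phi> t \<in> K"
proof -
  have "\<phi> ` closure {u<..<v} \<subseteq> K"
    by (rule image_closure_subset) (use assms in auto)
  then show ?thesis using assms by auto
qed

lemma field_arc_endpoints:
  assumes "u < v" "continuous_on {u..v} \<phi>" "field_arc X (closure K) {u<..<v} \<phi>" "t \<in> {u..v}"
  shows "\<phi> t \<in> closure K"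
  by (rule closed_endpoints[OF assms(1,2) closed_closure _ assms(4)])
    (use assms(3) in \<open>auto simp: field_arc_def\<close>)

lemma field_arc_inner_deriv:
  assumes "field_arc X K {u<..<v} \<phi>" "u < t" "t < v"
  shows "((\<lambda>t. e \<bullet> \<phi> t) has_real_derivative e \<bullet> X (\<phi> t)) (at t)"
proof -
  have "(\<phi> has_vector_derivative X (\<phi> t)) (at t)"
    using bspec[OF assms(1)[unfolded field_arc_def], of t] assms(2,3) at_within_open[of t "{u<..<v}"]
    by simp
  then show ?thesis
    unfolding has_real_derivative_iff_has_vector_derivative
    by (rule bounded_linear.has_vector_derivative[OF bounded_linear_inner_right])
qed

text \<open>The derivative of \<open>e \<bullet> \<phi>\<close> is the triple product of
  \<open>e\<close>, \<open>a\<close> and \<open>\<phi>\<close>, zero for \<open>e\<close> on the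
  axis. For \<open>a = 0\<close> every \<open>e\<close> is allowed, so a vanishing field is covered
  too.\<close>

lemma rotation_arc_first_integral:
  assumes uv: "u < v" "continuous_on {u..v} \<phi>" and arc: "field_arc X (closure K) {u<..<v} \<phi>"
    and X: "\<And>p. p \<in> closure K \<Longrightarrow> X p = a \<times> p" and e: "a \<times> e = 0"
  shows "e \<bullet> \<phi> v = e \<bullet> \<phi> u"
proof (rule DERIV_isconst_end[OF uv(1)])
  show "continuous_on {u..v} (\<lambda>t. e \<bullet> \<phi> t)" by (intro continuous_intros uv)
  fix t assume t: "u < t" "t < v"
  then have "\<phi> t \<in> closure K" using arc unfolding field_arc_def by auto
  then have "e \<bullet> X (\<phi> t) = (e \<times> a) \<bullet> \<phi> t"
    using cross_triple[of e a "\<phi> t"] by (simp add: X inner_commute)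
  also have "\<dots> = 0" using e cross_skew[of e a] by simp
  finally show "((\<lambda>t. e \<bullet> \<phi> t) has_real_derivative 0) (at t)"
    using field_arc_inner_deriv[OF arc t, of e] by simp
qed

lemma sliding_velocity_in_switching: "sliding_velocity Z p v \<Longrightarrow> p \<in> switching Z"
  unfolding sliding_velocity_def sliding_def escaping_def tangency_def by auto

section \<open>Linear fields on the sphere\<close>

text \<open>Tangency makes the quadratic form of \<open>A\<close> vanish on the sphere, and by
  homogeneity everywhere. So \<open>A\<close> is skew, and skew 3 by 3 matrices are cross
  products.\<close>

lemma tangent_linear_eq_cross:
  fixes A :: "real^3^3"
  assumes "\<forall>p\<in>S2. (A *v p) \<bullet> p = 0"
  obtains a where "\<And>p. A *v p = a \<times> p"
proof -
  have *: "(A *v p) \<bullet> p = 0" for p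
  proof (cases "p = 0")
    case False
    then have "(A *v ((1 / norm p) *\<^sub>R p)) \<bullet> ((1 / norm p) *\<^sub>R p) = 0"
      by (intro bspec[OF assms]) simp
    then show ?thesis using False by (simp add: matrix_vector_mult_scaleR)
  qed simp
  have d: "A $ i $ i = 0" for i
    using *[of "axis i 1"] by (simp add: matrix_vector_mult_basis inner_axis column_def)
  have "A $ i $ j + A $ j $ i = 0" for i j
    using *[of "axis i 1 + axis j 1"] d[of i] d[of j]
    by (simp add: matrix_vector_right_distrib matrix_vector_mult_basis inner_axis column_def
        inner_add_right)
  then have s: "A $ i $ j = - A $ j $ i" for i j
    by (simp add: eq_neg_iff_add_eq_0)
  have "A *v p = vector [A$3$2, A$1$3, A$2$1] \<times> p" for p
    by (simp add: vec_eq_iff forall_3 matrix_vector_mult_def sum_3 cross3_def d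
        s[of 1 2] s[of 2 3] s[of 3 1])
  then show ?thesis by (rule that)
qed

lemma inner_unit_eq_1_iff:
  fixes x y :: "'a::real_inner"
  assumes "norm x = 1" "norm y = 1"
  shows "x \<bullet> y = 1 \<longleftrightarrow> x = y"
proof -
  have "(norm (x - y))\<^sup>2 = 2 - 2 * (x \<bullet> y)"
    using assms by (simp add: power2_norm_eq_inner inner_diff inner_commute norm_eq_1)
  then show ?thesis by auto
qed

section \<open>Normal form: two rotations on the two sides of a circle\<close>

text \<open>The unit normal \<open>n\<close> points to the side of the positive zone, and
  \<open>\<bar>c\<bar> < 1\<close> says that the plane cuts the sphere in a proper circle.\<close>

locale two_rotations =
  fixes Z :: psvf and r :: nat and n a b :: vec3 and c :: real
  assumes psvf: "is_psvf r Z" and norm_n: "norm n = 1" and c: "\<bar>c\<bar> < 1"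
    and switching: "switching Z = {p \<in> S2. n \<bullet> p = c}"
    and zone_pos: "zone_pos Z = {p \<in> S2. c < n \<bullet> p}"
    and zone_neg: "zone_neg Z = {p \<in> S2. n \<bullet> p < c}"
    and pos: "\<And>p. p \<in> closure (zone_pos Z) \<Longrightarrow> field_pos Z p = a \<times> p"
    and neg: "\<And>p. p \<in> closure (zone_neg Z) \<Longrightarrow> field_neg Z p = b \<times> p"

lemma two_rotations_exist:
  assumes psvf: "is_psvf r Z" and circ: "is_circle (switching Z)" and lin: "piecewise_linear Z"
  obtains n a b c where "two_rotations Z r n a b c"
proof -
  obtain n' c' where n': "n' \<noteq> 0" "switching Z = S2 \<inter> {x. n' \<bullet> x = c'}"
    and nd: "\<not> (\<exists>p. switching Z \<subseteq> {p})"
    using circ unfolding is_circle_def by auto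
  define m where "m = (1 / norm n') *\<^sub>R n'"
  define d where "d = c' / norm n'"
  have m: "norm m = 1" using n' by (simp add: m_def)
  have "m \<bullet> p = d \<longleftrightarrow> n' \<bullet> p = c'" for p
    using n'(1) by (simp add: m_def d_def)
  then have sw: "switching Z = {p \<in> S2. m \<bullet> p = d}"
    using n'(2) by auto
  obtain p q where pq: "p \<in> switching Z" "q \<in> switching Z" "p \<noteq> q"
    using nd by blast
  have "\<bar>m \<bullet> p\<bar> \<le> 1" using Cauchy_Schwarz_ineq2[of m p] pq m sw by auto
  \<comment> \<open>At height 1 or -1 the plane would only touch the sphere, at \<open>m\<close> or
    \<open>-m\<close>, and the section would have one point.\<close>
  moreover have "d \<noteq> 1"
    using pq sw inner_unit_eq_1_iff[OF m, of p] inner_unit_eq_1_iff[OF m, of q] by auto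
  moreover have "d \<noteq> -1"
    using pq sw m inner_unit_eq_1_iff[of "-m" p] inner_unit_eq_1_iff[of "-m" q] by auto
  ultimately have d: "\<bar>d\<bar> < 1" using pq sw by auto
  define up where "up = {p \<in> S2. d < m \<bullet> p}"
  define dn where "dn = {p \<in> S2. m \<bullet> p < d}"
  have mm: "m \<in> up" "-m \<in> dn"
    using m d unfolding up_def dn_def by (auto simp: norm_eq_1)
  have "zone_pos Z \<union> zone_neg Z = S2 - switching Z"
    unfolding zone_pos_def zone_neg_def switching_def by auto
  moreover have "up \<union> dn = S2 - switching Z"
    unfolding sw up_def dn_def by auto
  ultimately have un: "zone_pos Z \<union> zone_neg Z = up \<union> dn" by simp
  have disj: "zone_pos Z \<inter> zone_neg Z = {}" "up \<inter> dn = {}"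
    unfolding zone_pos_def zone_neg_def up_def dn_def by auto
  have conn: "K \<subseteq> up \<or> K \<subseteq> dn" if "connected K" "K \<subseteq> up \<union> dn" for K
  proof -
    have "open {p. d < m \<bullet> p}" "open {p. m \<bullet> p < d}"
      by (simp_all add: open_halfspace_gt open_halfspace_lt)
    from connectedD[OF that(1) this] that(2) show ?thesis
      unfolding up_def dn_def by fastforce
  qed
  have "connected (zone_pos Z)" "connected (zone_neg Z)"
    using psvf unfolding is_psvf_def by simp_all
  moreover have "zone_pos Z \<subseteq> up \<union> dn" "zone_neg Z \<subseteq> up \<union> dn" unfolding un[symmetric] by simp_all
  ultimately have "zone_pos Z \<subseteq> up \<or> zone_pos Z \<subseteq> dn" "zone_neg Z \<subseteq> up \<or> zone_neg Z \<subseteq> dn"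
    using conn by simp_all
  \<comment> \<open>Each zone lies in one open cap by connectedness. Both caps are non-empty and
    have to be covered, so the zones are the caps in some order.\<close>
  then have zones: "zone_pos Z = up \<and> zone_neg Z = dn \<or> zone_pos Z = dn \<and> zone_neg Z = up"
    using un disj mm by blast
  obtain A where A: "\<forall>p\<in>S2. (A *v p) \<bullet> p = 0" "\<forall>p\<in>closure (zone_pos Z). field_pos Z p = A *v p"
    using lin unfolding piecewise_linear_def linear_on_zone_def by blast
  obtain B where B: "\<forall>p\<in>S2. (B *v p) \<bullet> p = 0" "\<forall>p\<in>closure (zone_neg Z). field_neg Z p = B *v p"
    using lin unfolding piecewise_linear_def linear_on_zone_def by blast
  obtain a where a: "\<And>p. A *v p = a \<times> p" using tangent_linear_eq_cross[OF A(1)] by blast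
  obtain b where b: "\<And>p. B *v p = b \<times> p" using tangent_linear_eq_cross[OF B(1)] by blast
  from zones show ?thesis
  proof
    assume "zone_pos Z = up \<and> zone_neg Z = dn"
    then have "two_rotations Z r m a b d"
      using psvf m d sw A(2) B(2) a b by unfold_locales (auto simp: up_def dn_def)
    then show ?thesis by (rule that)
  next
    \<comment> \<open>Reversing the normal turns the lower cap into the upper one.\<close>
    assume "zone_pos Z = dn \<and> zone_neg Z = up"
    then have "two_rotations Z r (-m) a b (-d)"
      using psvf m d sw A(2) B(2) a b by unfold_locales (auto simp: up_def dn_def)
    then show ?thesis by (rule that)
  qed
qed

section \<open>Invariant circles around a pole inside a zone\<close>

text \<open>Circles around a centre \<open>e\<close> of rotation that avoid \<open>K\<close> are invariant, which makes
  \<open>max (e \<bullet> p) m\<close> a first integral if \<open>m\<close> is the maximum of \<open>e \<bullet> p\<close> on \<open>K\<close>.\<close>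

lemma not_transitive_if_center:
  assumes e: "norm e = 1" "e \<notin> K" and K: "closed K" "K \<subseteq> S2" "K \<noteq> {}"
    and step: "\<And>u v \<phi>. joint_free_arc Z u v \<phi> \<Longrightarrow> e \<bullet> \<phi> v = e \<bullet> \<phi> u \<or> \<phi> u \<in> K \<and> \<phi> v \<in> K"
  shows "\<not> topologically_transitive Z"
proof -
  have "compact K" using K by (metis compact_Int_closed compact_sphere inf.absorb_iff2)
  moreover have "continuous_on K (\<lambda>x. e \<bullet> x)" by (intro continuous_intros)
  ultimately obtain y where y: "y \<in> K" "\<And>x. x \<in> K \<Longrightarrow> e \<bullet> x \<le> e \<bullet> y"
    using continuous_attains_sup[of K "\<lambda>x. e \<bullet> x"] K(3) by blast
  have ny: "norm y = 1" using y K by auto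
  \<comment> \<open>As \<open>e\<close> lies outside \<open>K\<close>, the maximum stays below
    \<open>e \<bullet> e = 1\<close>, which separates the values of \<open>H\<close> at
    \<open>e\<close> and \<open>y\<close>.\<close>
  have "e \<bullet> y \<noteq> 1" using inner_unit_eq_1_iff[OF e(1) ny] y e by auto
  moreover have "e \<bullet> y \<le> 1" using norm_cauchy_schwarz[of e y] e ny by simp
  ultimately have lt: "e \<bullet> y < 1" by simp
  define H where "H p = max (e \<bullet> p) (e \<bullet> y)" for p
  have HK: "H x = e \<bullet> y" if "x \<in> K" for x using y(2)[OF that] by (simp add: H_def)
  show ?thesis
  proof (rule not_transitive_if_first_integral[of H])
    show "continuous_on S2 H" unfolding H_def by (intro continuous_intros)
    show "e \<in> S2" "y \<in> S2" using e ny by auto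
    show "H e \<noteq> H y" using lt e(1) HK[OF y(1)] by (simp add: H_def norm_eq_1)
    show "H (\<phi> v) = H (\<phi> u)" if "joint_free_arc Z u v \<phi>" for u v \<phi>
      using step[OF that] HK by (auto simp: H_def)
  qed
qed

lemma sliding_arc_endpoints:
  assumes "u < v" "continuous_on {u..v} \<phi>" "sliding_arc Z {u<..<v} \<phi>" "t \<in> {u..v}"
    and "closed (switching Z)"
  shows "\<phi> t \<in> switching Z"
proof (rule closed_endpoints[OF assms(1,2,5) _ assms(4)])
  fix t assume "u < t" "t < v"
  then obtain w where "sliding_velocity Z (\<phi> t) w" using assms(3) unfolding sliding_arc_def by force
  then show "\<phi> t \<in> switching Z" by (rule sliding_velocity_in_switching)
qed

context two_rotations
begin

lemma closed_switching: "closed (switching Z)"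
proof -
  have "switching Z = S2 \<inter> {p. n \<bullet> p = c}" unfolding switching by blast
  then show ?thesis using closed_hyperplane[of n c] by (simp add: closed_Int)
qed

lemma closure_zone_pos: "closure (zone_pos Z) \<subseteq> {p \<in> S2. c \<le> n \<bullet> p}"
proof (rule closure_minimal)
  have "{p \<in> S2. c \<le> n \<bullet> p} = S2 \<inter> {p. n \<bullet> p \<ge> c}" by auto
  then show "closed {p \<in> S2. c \<le> n \<bullet> p}" by (simp add: closed_Int closed_halfspace_ge)
qed (auto simp: zone_pos)

lemma closure_zone_neg: "closure (zone_neg Z) \<subseteq> {p \<in> S2. n \<bullet> p \<le> c}"
proof (rule closure_minimal)
  have "{p \<in> S2. n \<bullet> p \<le> c} = S2 \<inter> {p. n \<bullet> p \<le> c}" by auto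
  then show "closed {p \<in> S2. n \<bullet> p \<le> c}" by (simp add: closed_Int closed_halfspace_le)
qed (auto simp: zone_neg)

lemma n_n: "n \<bullet> n = 1"
  using norm_n by (simp add: norm_eq_1)

text \<open>\<open>K\<close> is the closed cap on the other side. Pieces in the negative zone and
  sliding pieces begin and end in it; pieces in the positive zone keep their distance from the pole
  \<open>e\<close>.\<close>

lemma not_transitive_if_center_pos:
  assumes e: "norm e = 1" "a \<times> e = 0" "c < n \<bullet> e"
  shows "\<not> topologically_transitive Z"
proof (rule not_transitive_if_center[of e "S2 \<inter> {p. n \<bullet> p \<le> c}"])
  show "closed (S2 \<inter> {p. n \<bullet> p \<le> c})" by (simp add: closed_Int closed_halfspace_le)
  show "S2 \<inter> {p. n \<bullet> p \<le> c} \<noteq> {}"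
    using c norm_n n_n by (auto intro!: exI[of _ "-n"] simp: set_eq_iff)
  show "e \<bullet> \<phi> v = e \<bullet> \<phi> u \<or> \<phi> u \<in> S2 \<inter> {p. n \<bullet> p \<le> c} \<and> \<phi> v \<in> S2 \<inter> {p. n \<bullet> p \<le> c}"
    if "joint_free_arc Z u v \<phi>" for u v \<phi>
    using that
  proof (cases rule: joint_free_arc_cases)
    case pos
    show ?thesis
      using rotation_arc_first_integral[OF pos two_rotations.pos[OF two_rotations_axioms] e(2)] by simp
  next
    case neg
    from field_arc_endpoints[OF neg, of u] field_arc_endpoints[OF neg, of v] neg(1)
    show ?thesis using closure_zone_neg by auto
  next
    case sliding
    from sliding_arc_endpoints[OF sliding _ closed_switching, of u]
      sliding_arc_endpoints[OF sliding _ closed_switching, of v] sliding(1)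
    show ?thesis using switching by auto
  qed
qed (use e in auto)

lemma not_transitive_if_center_neg:
  assumes e: "norm e = 1" "b \<times> e = 0" "n \<bullet> e < c"
  shows "\<not> topologically_transitive Z"
proof (rule not_transitive_if_center[of e "S2 \<inter> {p. n \<bullet> p \<ge> c}"])
  show "closed (S2 \<inter> {p. n \<bullet> p \<ge> c})" by (simp add: closed_Int closed_halfspace_ge)
  show "S2 \<inter> {p. n \<bullet> p \<ge> c} \<noteq> {}"
    using c norm_n n_n by (auto intro!: exI[of _ n] simp: set_eq_iff)
  show "e \<bullet> \<phi> v = e \<bullet> \<phi> u \<or> \<phi> u \<in> S2 \<inter> {p. n \<bullet> p \<ge> c} \<and> \<phi> v \<in> S2 \<inter> {p. n \<bullet> p \<ge> c}"
    if "joint_free_arc Z u v \<phi>" for u v \<phi>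
    using that
  proof (cases rule: joint_free_arc_cases)
    case pos
    from field_arc_endpoints[OF pos, of u] field_arc_endpoints[OF pos, of v] pos(1)
    show ?thesis using closure_zone_pos by auto
  next
    case neg
    show ?thesis
      using rotation_arc_first_integral[OF neg two_rotations.neg[OF two_rotations_axioms] e(2)] by simp
  next
    case sliding
    from sliding_arc_endpoints[OF sliding _ closed_switching, of u]
      sliding_arc_endpoints[OF sliding _ closed_switching, of v] sliding(1)
    show ?thesis using switching by auto
  qed
qed (use e in auto)

lemma transitive_imp_horizontal_axes:
  assumes T: "topologically_transitive Z"
  shows "c = 0" "a \<bullet> n = 0" "b \<bullet> n = 0" "a \<noteq> 0" "b \<noteq> 0"
proof -
  have P: "n \<bullet> e \<le> c" if "norm e = 1" "a \<times> e = 0" for e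
    using not_transitive_if_center_pos that T by force
  have N: "c \<le> n \<bullet> e" if "norm e = 1" "b \<times> e = 0" for e
    using not_transitive_if_center_neg that T by force
  \<comment> \<open>If \<open>a = 0\<close>, every unit vector is a centre, in particular
    \<open>n\<close>, the midpoint of the positive cap.\<close>
  show a: "a \<noteq> 0" using P[of n] c norm_n n_n by auto
  show b: "b \<noteq> 0" using N[of "-n"] c norm_n n_n by auto
  \<comment> \<open>Both poles of the first rotation miss the positive zone, which bounds
    \<open>\<bar>n \<bullet> a\<bar>\<close> by \<open>c * norm a\<close> and forces
    \<open>c \<ge> 0\<close>. In the same way the second rotation forces
    \<open>c \<le> 0\<close>.\<close>
  have "n \<bullet> a \<le> c * norm a" "- (n \<bullet> a) \<le> c * norm a"
    using P[of "(1 / norm a) *\<^sub>R a"] P[of "- (1 / norm a) *\<^sub>R a"] a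
    by (simp_all add: cross_mult_right field_simps)
  moreover have "c * norm b \<le> n \<bullet> b" "c * norm b \<le> - (n \<bullet> b)"
    using N[of "(1 / norm b) *\<^sub>R b"] N[of "- (1 / norm b) *\<^sub>R b"] b
    by (simp_all add: cross_mult_right field_simps)
  moreover from calculation have "0 \<le> c * norm a" "c * norm b \<le> 0" by linarith+
  then show "c = 0" using a b by (simp add: zero_le_mult_iff mult_le_0_iff)
  ultimately show "a \<bullet> n = 0" "b \<bullet> n = 0" by (simp_all add: inner_commute)
qed

end
section \<open>Horizontal axes\<close>

lemma horizontal_cross:
  assumes n: "n \<bullet> n = 1" and a: "a \<bullet> n = 0" and p: "n \<bullet> p = 0"
  shows "a \<times> p = ((a \<times> p) \<bullet> n) *\<^sub>R n"
proof -
  have "n \<times> (a \<times> p) = 0" using Lagrange[of n a p] a p by (simp add: inner_commute)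
  then have "n \<times> (n \<times> (a \<times> p)) = 0" by simp
  then show ?thesis using Lagrange[of n n "a \<times> p"] n by (simp add: inner_commute)
qed

text \<open>For \<open>a \<noteq> 0\<close> the vectors \<open>a\<close> and
  \<open>n \<times> a\<close> are an orthogonal basis of the plane, both of squared length
  \<open>a \<bullet> a\<close>; the second coefficient is the triple product
  \<open>(n \<times> a) \<bullet> p\<close>.\<close>

lemma horizontal_decomposition:
  assumes n: "n \<bullet> n = 1" and a: "a \<bullet> n = 0" and p: "n \<bullet> p = 0"
  shows "(a \<bullet> a) *\<^sub>R p = (a \<bullet> p) *\<^sub>R a + ((a \<times> p) \<bullet> n) *\<^sub>R (n \<times> a)"
proof -
  have "a \<times> (a \<times> p) = ((a \<times> p) \<bullet> n) *\<^sub>R (a \<times> n)"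
    using horizontal_cross[OF assms] by (metis cross_mult_right)
  then have "a \<times> (a \<times> p) = - (((a \<times> p) \<bullet> n) *\<^sub>R (n \<times> a))"
    using cross_skew[of a n] by simp
  then show ?thesis using Lagrange[of a a p] by (simp add: algebra_simps)
qed

text \<open>\<open>p\<close>, \<open>n \<times> p\<close> and \<open>n\<close> form an orthonormal
  frame.\<close>

lemma orthogonal_imp_multiple_normal:
  assumes n: "n \<bullet> n = 1" and p: "p \<bullet> p = 1" "n \<bullet> p = 0" and g: "g \<bullet> p = 0" "g \<bullet> (n \<times> p) = 0"
  shows "g = (g \<bullet> n) *\<^sub>R n"
proof -
  let ?\<tau> = "n \<times> p"
  have 1: "?\<tau> \<bullet> ?\<tau> = 1"
    using norm_cross_dot[of n p] n p by (simp add: power2_norm_eq_inner power_mult_distrib)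
  have 2: "g \<times> ?\<tau> = - ((g \<bullet> n) *\<^sub>R p)" using Lagrange[of g n p] g by simp
  have 3: "?\<tau> \<times> p = - n" using Lagrange[of p n p] p cross_skew[of ?\<tau> p] by (simp add: inner_commute)
  have "?\<tau> \<times> (g \<times> ?\<tau>) = g" using Lagrange[of ?\<tau> g ?\<tau>] 1 g by (simp add: inner_commute)
  then show ?thesis unfolding 2 by (simp add: 3 cross_mult_right)
qed

lemma great_circle_arc_unit:
  fixes p w :: vec3
  assumes "p \<bullet> p = 1" "w \<bullet> w = 1" "w \<bullet> p = 0"
  shows "cos t *\<^sub>R p + sin t *\<^sub>R w \<in> S2"
proof -
  have "(cos t *\<^sub>R p + sin t *\<^sub>R w) \<bullet> (cos t *\<^sub>R p + sin t *\<^sub>R w) = (cos t)\<^sup>2 + (sin t)\<^sup>2"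
    using assms by (simp add: inner_add inner_commute power2_eq_square)
  then show ?thesis by (simp add: norm_eq_1)
qed

lemma differentiable_switch_fun:
  assumes "is_psvf r Z" "p \<in> S2"
  shows "switch_fun Z differentiable (at p)"
proof -
  obtain U where U: "open U" "S2 \<subseteq> U" "\<forall>k. Ck_on k U (switch_fun Z)"
    using assms(1) unfolding is_psvf_def by auto
  have "switch_fun Z differentiable_on U" using U(3)[rule_format, of 1] by simp
  then show ?thesis
    using U(1,2) assms(2) unfolding differentiable_on_def by (metis at_within_open subsetD)
qed

lemma gradient_inner:
  assumes "f differentiable (at p)"
  shows "gradient f p \<bullet> w = frechet_derivative f (at p) w"
proof -
  have lin: "linear (frechet_derivative f (at p))"
    using assms by (rule linear_frechet_derivative)
  have "frechet_derivative f (at p) w = frechet_derivative f (at p) (\<Sum>b\<in>Basis. (w \<bullet> b) *\<^sub>R b)"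
    by (simp only: euclidean_representation)
  also have "\<dots> = (\<Sum>b\<in>Basis. (w \<bullet> b) * frechet_derivative f (at p) b)"
    using lin by (simp add: linear_sum linear_scale)
  finally show ?thesis
    unfolding gradient_def inner_sum_left inner_scaleR_left
    by (simp add: inner_commute mult.commute)
qed

text \<open>The curve passes through \<open>p\<close> with velocity \<open>w\<close>. If both are
  orthonormal it runs on the sphere, so the signs of \<open>f\<close> on the sphere restrict its
  gradient.\<close>

lemma great_circle_deriv:
  assumes "f differentiable (at p)"
  shows "((\<lambda>t. f (cos t *\<^sub>R p + sin t *\<^sub>R w)) has_real_derivative gradient f p \<bullet> w) (at 0)"
proof -
  have "((\<lambda>t. cos t *\<^sub>R p + sin t *\<^sub>R w) has_vector_derivative w) (at 0)"
    by (auto intro!: derivative_eq_intros simp: has_vector_derivative_def)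
  moreover have "(f has_derivative frechet_derivative f (at p)) (at (cos 0 *\<^sub>R p + sin 0 *\<^sub>R w))"
    using assms[unfolded frechet_derivative_works] by simp
  ultimately have "(f \<circ> (\<lambda>t. cos t *\<^sub>R p + sin t *\<^sub>R w) has_vector_derivative
      frechet_derivative f (at p) w) (at 0)"
    by (rule vector_derivative_diff_chain_within[OF _ has_derivative_at_withinI])
  then show ?thesis
    unfolding has_real_derivative_iff_has_vector_derivative gradient_inner[OF assms] o_def .
qed

section \<open>Gradient of the switching function and vanishing of the sliding field\<close>

locale horizontal_rotations = two_rotations Z r n a b 0 for Z r n a b +
  assumes a_n: "a \<bullet> n = 0" and b_n: "b \<bullet> n = 0" and a_nz: "a \<noteq> 0" and b_nz: "b \<noteq> 0"
begin

lemma switchingD: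
  assumes "p \<in> switching Z"
  shows "p \<in> S2" "p \<bullet> p = 1" "n \<bullet> p = 0"
  using assms by (auto simp: switching norm_eq_1)

text \<open>The switching function vanishes along the circle, which kills the component along
  \<open>n \<times> p\<close>. It is positive on the arc from \<open>p\<close> towards
  \<open>n\<close>, which gives the sign; regularity excludes zero.\<close>

lemma surface_gradient_switch_fun:
  assumes p: "p \<in> switching Z"
  obtains l where "l > 0" "surface_gradient (switch_fun Z) p = l *\<^sub>R n"
proof -
  let ?f = "switch_fun Z"
  let ?g = "surface_gradient ?f p"
  let ?\<tau> = "n \<times> p"
  note pp = switchingD[OF p]
  note diff = differentiable_switch_fun[OF psvf pp(1)]
  have \<tau>: "?\<tau> \<bullet> ?\<tau> = 1" "?\<tau> \<bullet> p = 0" "n \<bullet> ?\<tau> = 0"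
    using norm_cross_dot[of n p] n_n pp
    by (simp_all add: power2_norm_eq_inner power_mult_distrib dot_cross_self)
  have "?f (cos t *\<^sub>R p + sin t *\<^sub>R ?\<tau>) = 0" for t
  proof -
    have "cos t *\<^sub>R p + sin t *\<^sub>R ?\<tau> \<in> {q \<in> S2. n \<bullet> q = 0}"
      using great_circle_arc_unit[OF pp(2) \<tau>(1,2)] pp(3) \<tau>(3) by (simp add: inner_add_right)
    then show ?thesis unfolding switching[symmetric] switching_def by simp
  qed
  then have "gradient ?f p \<bullet> ?\<tau> = 0"
    using great_circle_deriv[OF diff, of ?\<tau>] DERIV_unique[OF _ DERIV_const] by simp
  then have g\<tau>: "?g \<bullet> ?\<tau> = 0"
    using \<tau>(2) inner_commute[of p ?\<tau>] by (simp add: surface_gradient_def inner_diff_left)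
  have gp: "?g \<bullet> p = 0" using pp by (simp add: surface_gradient_def inner_diff_left)
  have fpos: "?f (cos t *\<^sub>R p + sin t *\<^sub>R n) > 0" if "0 < t" "t < pi" for t
  proof -
    have "cos t *\<^sub>R p + sin t *\<^sub>R n \<in> {q \<in> S2. 0 < n \<bullet> q}"
      using great_circle_arc_unit[OF pp(2) n_n pp(3)] pp(3) n_n sin_gt_zero[OF that]
      by (simp add: inner_add_right)
    then show ?thesis unfolding zone_pos[symmetric] zone_pos_def by simp
  qed
  \<comment> \<open>A negative slope would carry the function below its value 0 at \<open>p\<close>,
    on an arc that lies in the positive zone.\<close>
  have "gradient ?f p \<bullet> n \<ge> 0"
  proof (rule ccontr)
    assume "\<not> gradient ?f p \<bullet> n \<ge> 0"
    then obtain d where d: "d > 0" "\<And>h. h > 0 \<Longrightarrow> h < d \<Longrightarrow> ?f (cos h *\<^sub>R p + sin h *\<^sub>R n) < ?f p"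
      using DERIV_neg_dec_right[OF great_circle_deriv[OF diff, of n]] by auto
    moreover define h where "h = min (d / 2) 1"
    ultimately have "0 < h" "h < d" "h < pi" using pi_gt3 by (auto simp: h_def min_def)
    then show False using fpos[of h] d(2)[of h] p unfolding switching_def by simp
  qed
  then have "?g \<bullet> n \<ge> 0"
    using pp inner_commute[of p n] by (simp add: surface_gradient_def inner_diff_left)
  moreover have g: "?g = (?g \<bullet> n) *\<^sub>R n"
    by (rule orthogonal_imp_multiple_normal[OF n_n pp(2,3) gp g\<tau>])
  moreover have "?g \<noteq> 0" using psvf p unfolding is_psvf_def by blast
  ultimately have "?g \<bullet> n > 0" by (metis order_le_less scaleR_zero_left)
  then show ?thesis using g by (rule that)
qed

lemma switching_closure_zones:
  assumes p: "p \<in> switching Z"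
  shows "p \<in> closure (zone_pos Z)" "p \<in> closure (zone_neg Z)"
proof -
  note pp = switchingD[OF p]
  have "cos t *\<^sub>R p + sin t *\<^sub>R n \<in> closure (zone_pos Z)"
    "cos t *\<^sub>R p + sin t *\<^sub>R (- n) \<in> closure (zone_neg Z)" if "0 < t" "t < 1" for t
  proof -
    have t: "sin t > 0" using that pi_gt3 by (intro sin_gt_zero) auto
    have "cos t *\<^sub>R p + sin t *\<^sub>R n \<in> zone_pos Z"
      using great_circle_arc_unit[OF pp(2) n_n pp(3)] pp(3) n_n t
      by (simp add: zone_pos inner_add_right)
    moreover have "cos t *\<^sub>R p + sin t *\<^sub>R (- n) \<in> zone_neg Z"
      using great_circle_arc_unit[OF pp(2), of "- n" t] pp(3) n_n t
      by (simp add: zone_neg inner_diff_right)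
    ultimately show "cos t *\<^sub>R p + sin t *\<^sub>R n \<in> closure (zone_pos Z)"
      "cos t *\<^sub>R p + sin t *\<^sub>R (- n) \<in> closure (zone_neg Z)"
      using closure_subset by blast+
  qed
  note mem = this
  have cont: "continuous_on {0..1} (\<lambda>t. cos t *\<^sub>R p + sin t *\<^sub>R w)" for w
    by (intro continuous_intros)
  show "p \<in> closure (zone_pos Z)"
    using closed_endpoints[OF zero_less_one cont closed_closure mem(1), of 0] by simp
  show "p \<in> closure (zone_neg Z)"
    using closed_endpoints[OF zero_less_one cont closed_closure mem(2), of 0] by simp
qed

text \<open>Both derivatives share the positive factor \<open>l\<close>, so the type of a point is
  decided by the components of the two fields along \<open>n\<close>.\<close>

lemma lie_switching:
  assumes p: "p \<in> switching Z"
  obtains l where "l > 0" "lie_pos Z p = l * ((a \<times> p) \<bullet> n)" "lie_neg Z p = l * ((b \<times> p) \<bullet> n)"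
proof -
  obtain l where "l > 0" "surface_gradient (switch_fun Z) p = l *\<^sub>R n"
    by (rule surface_gradient_switch_fun[OF p])
  then show ?thesis
    using pos[OF switching_closure_zones(1)[OF p]] neg[OF switching_closure_zones(2)[OF p]]
    by (intro that) (auto simp: lie_pos_def lie_neg_def)
qed

text \<open>On the circle both fields are multiples of \<open>n\<close>, so the combination without
  normal component is zero. The numerator itself vanishes, so the equation also holds where the
  denominator is 0.\<close>

lemma convex_field_eq_0:
  assumes p: "p \<in> switching Z"
  shows "convex_field Z p = 0"
proof -
  obtain l where l: "lie_pos Z p = l * ((a \<times> p) \<bullet> n)" "lie_neg Z p = l * ((b \<times> p) \<bullet> n)"
    by (rule lie_switching[OF p])
  have e: "field_pos Z p = ((a \<times> p) \<bullet> n) *\<^sub>R n" "field_neg Z p = ((b \<times> p) \<bullet> n) *\<^sub>R n"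
    using pos[OF switching_closure_zones(1)[OF p]] neg[OF switching_closure_zones(2)[OF p]]
      horizontal_cross[OF n_n a_n switchingD(3)[OF p]] horizontal_cross[OF n_n b_n switchingD(3)[OF p]]
    by auto
  show ?thesis unfolding convex_field_def l e by simp
qed

lemma sliding_velocity_eq_0:
  assumes "sliding_velocity Z p v"
  shows "v = 0"
  using assms unfolding sliding_velocity_def
proof (elim disjE conjE)
  assume "p \<in> sliding Z \<union> escaping Z" "v = convex_field Z p"
  then show "v = 0" using convex_field_eq_0 by (auto simp: sliding_def escaping_def)
next
  let ?S = "sliding Z \<union> escaping Z"
  assume lim: "p islimpt ?S" "(convex_field Z \<longlongrightarrow> v) (at p within ?S)"
  have "((\<lambda>_. 0) \<longlongrightarrow> v) (at p within ?S)"
    by (rule Lim_transform_within[OF lim(2) zero_less_one])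
      (auto simp: convex_field_eq_0 sliding_def escaping_def)
  \<comment> \<open>Limits are unique here because \<open>p\<close> is a limit point of the
    region.\<close>
  then show "v = 0"
    using lim(1) by (metis tendsto_const_iff trivial_limit_within)
qed

lemma sliding_arc_constant:
  assumes uv: "u < v" "continuous_on {u..v} \<phi>" and arc: "sliding_arc Z {u<..<v} \<phi>"
  shows "\<phi> v = \<phi> u"
proof (rule euclidean_eqI)
  fix e :: vec3
  have "\<phi> v \<bullet> e = \<phi> u \<bullet> e"
  proof (rule DERIV_isconst_end[OF uv(1)])
    show "continuous_on {u..v} (\<lambda>t. \<phi> t \<bullet> e)" by (intro continuous_intros uv)
    fix t assume t: "u < t" "t < v"
    then obtain w where "sliding_velocity Z (\<phi> t) w"
      "(\<phi> has_vector_derivative w) (at t within {u<..<v})"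
      using arc unfolding sliding_arc_def by force
    then have "(\<phi> has_vector_derivative 0) (at t)"
      using sliding_velocity_eq_0[of "\<phi> t" w] at_within_open[of t "{u<..<v}"] t by simp
    then show "((\<lambda>t. \<phi> t \<bullet> e) has_real_derivative 0) (at t)"
      unfolding has_real_derivative_iff_has_vector_derivative
      using bounded_linear.has_vector_derivative[OF bounded_linear_inner_left] by fastforce
  qed
  then show "\<phi> v \<bullet> e = \<phi> u \<bullet> e" .
qed

end

section \<open>Axes of the same direction, and the trap at the sliding arc\<close>

context horizontal_rotations
begin

lemma not_transitive_if_same_direction:
  assumes b: "b = k *\<^sub>R a" and k: "k > 0"
  shows "\<not> topologically_transitive Z"
proof (rule not_transitive_if_first_integral[of "\<lambda>p. a \<bullet> p"])
  show "continuous_on S2 (\<lambda>p. a \<bullet> p)" by (intro continuous_intros)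
  show "(1 / norm a) *\<^sub>R a \<in> S2" "- (1 / norm a) *\<^sub>R a \<in> S2" using a_nz by auto
  show "a \<bullet> ((1 / norm a) *\<^sub>R a) \<noteq> a \<bullet> (- (1 / norm a) *\<^sub>R a)" using a_nz by auto
  have "sliding Z \<union> escaping Z = {}"
  proof -
    \<comment> \<open>The normal components differ by the positive factor \<open>k\<close>, so their
      product is never negative.\<close>
    have False if p: "p \<in> switching Z" and lt: "lie_pos Z p * lie_neg Z p < 0" for p
    proof -
      obtain l where "l > 0" "lie_pos Z p = l * ((a \<times> p) \<bullet> n)" "lie_neg Z p = l * ((b \<times> p) \<bullet> n)"
        by (rule lie_switching[OF p])
      then have "lie_pos Z p * lie_neg Z p = k * (l * ((a \<times> p) \<bullet> n))\<^sup>2"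
        by (simp add: b cross_mult_left power2_eq_square)
      then show False using lt k by (simp add: mult_less_0_iff)
    qed
    then show ?thesis
      unfolding sliding_def escaping_def by (auto dest: mult_pos_neg mult_neg_pos)
  qed
  then have none: "\<not> sliding_velocity Z p v" for p v
    unfolding sliding_velocity_def by (simp add: islimpt_EMPTY)
  show "a \<bullet> \<phi> v = a \<bullet> \<phi> u" if "joint_free_arc Z u v \<phi>" for u v \<phi>
    using that
  proof (cases rule: joint_free_arc_cases)
    case pos
    show ?thesis
      by (rule rotation_arc_first_integral[OF pos two_rotations.pos[OF two_rotations_axioms] cross_refl])
  next
    case neg
    have "b \<times> a = 0" by (simp add: b cross_mult_left)
    from rotation_arc_first_integral[OF neg two_rotations.neg[OF two_rotations_axioms] this]
    show ?thesis .
  next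
    case sliding
    then obtain t where "u < t" "t < v" using dense by blast
    then show ?thesis using sliding(3) none unfolding sliding_arc_def by force
  qed
qed

text \<open>On the positive side \<open>n \<bullet> p\<close> is a concave function of time, so a descent to the switching circle
  ends with \<open>(a \<times> p) \<bullet> n < 0\<close>; by assumption such a landing point is a sliding point.\<close>

lemma joint_free_arc_trapped:
  assumes arc: "joint_free_arc Z u v \<phi>"
    and land: "\<And>p. p \<in> S2 \<Longrightarrow> n \<bullet> p = 0 \<Longrightarrow> a \<bullet> p = h \<Longrightarrow> (a \<times> p) \<bullet> n < 0 \<Longrightarrow> (b \<times> p) \<bullet> n > 0"
    and u: "a \<bullet> \<phi> u = h" "n \<bullet> \<phi> u > 0 \<or> n \<bullet> \<phi> u = 0 \<and> (a \<times> \<phi> u) \<bullet> n < 0 \<and> (b \<times> \<phi> u) \<bullet> n > 0"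
  shows "a \<bullet> \<phi> v = h \<and> (n \<bullet> \<phi> v > 0 \<or> n \<bullet> \<phi> v = 0 \<and> (a \<times> \<phi> v) \<bullet> n < 0 \<and> (b \<times> \<phi> v) \<bullet> n > 0)"
proof -
  \<comment> \<open>With \<open>z = n \<bullet> \<phi>\<close> and
    \<open>f = (d \<times> \<phi>) \<bullet> n\<close> this is the oscillator \<open>z' = f\<close>,
    \<open>f' = - (d \<bullet> d) * z\<close>. In each closed zone \<open>z\<close> has a fixed
    sign, so \<open>f\<close> is monotone.\<close>
  have rot: "((\<lambda>t. n \<bullet> \<phi> t) has_real_derivative (d \<times> \<phi> t) \<bullet> n) (at t)"
    "((\<lambda>t. (d \<times> \<phi> t) \<bullet> n) has_real_derivative - (d \<bullet> d) * (n \<bullet> \<phi> t)) (at t)"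
    if arc: "field_arc X (closure K) {u<..<v} \<phi>" and X: "\<And>p. p \<in> closure K \<Longrightarrow> X p = d \<times> p"
      and d: "d \<bullet> n = 0" and t: "u < t" "t < v" for X d t K
  proof -
    have X: "X (\<phi> t) = d \<times> \<phi> t" using arc t X unfolding field_arc_def by auto
    show "((\<lambda>t. n \<bullet> \<phi> t) has_real_derivative (d \<times> \<phi> t) \<bullet> n) (at t)"
      using field_arc_inner_deriv[OF arc t, of n] unfolding X by (simp add: inner_commute)
    have e: "(d \<times> p) \<bullet> n = (n \<times> d) \<bullet> p" for p
      using cross_triple[of n d p] by simp
    have "(n \<times> d) \<bullet> (d \<times> \<phi> t) = - (d \<bullet> d) * (n \<bullet> \<phi> t)"
      using d by (simp add: dot_cross inner_commute)
    then show "((\<lambda>t. (d \<times> \<phi> t) \<bullet> n) has_real_derivative - (d \<bullet> d) * (n \<bullet> \<phi> t)) (at t)"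
      using field_arc_inner_deriv[OF arc t, of "n \<times> d"] unfolding X e by simp
  qed
  have contz: "continuous_on {u..v} (\<lambda>t. n \<bullet> \<phi> t)" if "continuous_on {u..v} \<phi>"
    by (intro continuous_intros that)
  have contf: "continuous_on {u..t} (\<lambda>t. (d \<times> \<phi> t) \<bullet> n)" if "continuous_on {u..v} \<phi>" "t \<le> v" for d t
    by (intro continuous_intros continuous_on_cross continuous_on_subset[OF that(1)]) (use that in auto)
  show ?thesis
    using arc
  proof (cases rule: joint_free_arc_cases)
    case pos
    note rot' = rot[OF pos(3) two_rotations.pos[OF two_rotations_axioms] a_n]
    have cl: "\<phi> t \<in> S2" "n \<bullet> \<phi> t \<ge> 0" if "t \<in> {u..v}" for t
      using field_arc_endpoints[OF pos that] closure_zone_pos by auto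
    have antimono: "(a \<times> \<phi> t) \<bullet> n \<le> (a \<times> \<phi> s) \<bullet> n" if "u \<le> s" "s \<le> t" "t \<le> v" for s t
    proof (rule DERIV_nonpos_imp_decreasing_open[OF that(2)])
      show "continuous_on {s..t} (\<lambda>t. (a \<times> \<phi> t) \<bullet> n)"
        by (rule continuous_on_subset[OF contf[OF pos(2) that(3)]]) (use that in auto)
      fix x assume "s < x" "x < t"
      then have "u < x" "x < v" using that by auto
      then show "\<exists>y. ((\<lambda>t. (a \<times> \<phi> t) \<bullet> n) has_real_derivative y) (at x) \<and> y \<le> 0"
        using rot'(2)[of x] cl(2)[of x] by (intro exI[of _ "- (a \<bullet> a) * (n \<bullet> \<phi> x)"]) simp
    qed
    have h: "a \<bullet> \<phi> v = h"
      using rotation_arc_first_integral[OF pos two_rotations.pos[OF two_rotations_axioms] cross_refl] u(1)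
      by simp
    from u(2) show ?thesis
    proof
      assume up: "n \<bullet> \<phi> u > 0"
      show ?thesis
      proof (cases "n \<bullet> \<phi> v > 0")
        case False
        then have z: "n \<bullet> \<phi> v = 0" using cl(2)[of v] pos(1) by simp
        \<comment> \<open>Since \<open>f\<close> does not increase, \<open>f \<ge> 0\<close> at the
          end means \<open>f \<ge> 0\<close> throughout, and then \<open>z\<close> cannot have come
          down to 0.\<close>
        have "(a \<times> \<phi> v) \<bullet> n < 0"
        proof (rule ccontr)
          assume neg: "\<not> (a \<times> \<phi> v) \<bullet> n < 0"
          have "n \<bullet> \<phi> u \<le> n \<bullet> \<phi> v"
          proof (rule DERIV_nonneg_imp_increasing_open[OF less_imp_le[OF pos(1)] _ contz[OF pos(2)]])
            fix x assume "u < x" "x < v"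
            then show "\<exists>y. ((\<lambda>t. n \<bullet> \<phi> t) has_real_derivative y) (at x) \<and> y \<ge> 0"
              using rot'(1)[of x] antimono[of x v] neg by (intro exI[of _ "(a \<times> \<phi> x) \<bullet> n"]) simp
          qed
          then show False using up z by simp
        qed
        then show ?thesis using land[of "\<phi> v"] cl(1)[of v] pos(1) z h by simp
      qed (use h in simp)
    next
      assume dn: "n \<bullet> \<phi> u = 0 \<and> (a \<times> \<phi> u) \<bullet> n < 0 \<and> (b \<times> \<phi> u) \<bullet> n > 0"
      \<comment> \<open>Started on the circle with downward velocity, the arc would leave the closed
        positive zone: a contradiction.\<close>
      have "n \<bullet> \<phi> u > n \<bullet> \<phi> v"
      proof (rule DERIV_neg_imp_decreasing_open[OF pos(1) _ contz[OF pos(2)]])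
        fix x assume "u < x" "x < v"
        then show "\<exists>y. ((\<lambda>t. n \<bullet> \<phi> t) has_real_derivative y) (at x) \<and> y < 0"
          using rot'(1)[of x] antimono[of u x] dn by (intro exI[of _ "(a \<times> \<phi> x) \<bullet> n"]) simp
      qed
      then show ?thesis using dn cl(2)[of v] pos(1) by simp
    qed
  next
    case neg
    note rot' = rot[OF neg(3) two_rotations.neg[OF two_rotations_axioms] b_n]
    have cl: "n \<bullet> \<phi> t \<le> 0" if "t \<in> {u..v}" for t
      using field_arc_endpoints[OF neg that] closure_zone_neg by auto
    \<comment> \<open>An arc in the negative zone can only start on the circle, where the second
      field points up and would carry it out of that zone.\<close>
    have "n \<bullet> \<phi> u \<le> 0" using cl[of u] neg(1) by simp
    then have z: "n \<bullet> \<phi> u = 0" and f: "(b \<times> \<phi> u) \<bullet> n > 0"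
      using u(2) by auto
    have mono: "(b \<times> \<phi> u) \<bullet> n \<le> (b \<times> \<phi> t) \<bullet> n" if "u \<le> t" "t \<le> v" for t
    proof (rule DERIV_nonneg_imp_increasing_open[OF that(1) _ contf[OF neg(2) that(2)]])
      fix x assume "u < x" "x < t"
      then have "u < x" "x < v" using that by auto
      then show "\<exists>y. ((\<lambda>t. (b \<times> \<phi> t) \<bullet> n) has_real_derivative y) (at x) \<and> y \<ge> 0"
        using rot'(2)[of x] cl[of x]
        by (intro exI[of _ "- (b \<bullet> b) * (n \<bullet> \<phi> x)"]) (simp add: mult_nonneg_nonpos)
    qed
    have "n \<bullet> \<phi> u < n \<bullet> \<phi> v"
    proof (rule DERIV_pos_imp_increasing_open[OF neg(1) _ contz[OF neg(2)]])
      fix x assume "u < x" "x < v"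
      then show "\<exists>y. ((\<lambda>t. n \<bullet> \<phi> t) has_real_derivative y) (at x) \<and> y > 0"
        using rot'(1)[of x] mono[of x] f by (intro exI[of _ "(b \<times> \<phi> x) \<bullet> n"]) simp
    qed
    then show ?thesis using z cl[of v] neg(1) by simp
  next
    case sliding
    show ?thesis using sliding_arc_constant[OF sliding] u by simp
  qed
qed

text \<open>Where the first field points down, the normal component of the second depends only on
  the level \<open>a \<bullet> p\<close>, through \<open>q\<close>. This function is positive
  somewhere on the closed range of levels, hence on an interval inside it.\<close>

lemma sliding_interval:
  assumes "\<And>k. k > 0 \<Longrightarrow> b \<noteq> k *\<^sub>R a"
  obtains x y where "x < y" "- norm a < x" "y < norm a"
    "\<And>p. p \<in> S2 \<Longrightarrow> n \<bullet> p = 0 \<Longrightarrow> a \<bullet> p \<in> {x<..<y} \<Longrightarrow> (a \<times> p) \<bullet> n < 0 \<Longrightarrow> (b \<times> p) \<bullet> n > 0"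
proof -
  define A where "A = a \<bullet> a"
  define C where "C = a \<bullet> b"
  define D where "D = a \<bullet> (n \<times> b)"
  have A: "A > 0" "norm a = sqrt A" using a_nz by (simp_all add: A_def norm_eq_sqrt_inner)
  have e: "(d \<times> p) \<bullet> n = (n \<times> d) \<bullet> p" for d p
    using cross_triple[of n d p] by simp
  \<comment> \<open>On level \<open>x\<close> the root is
    \<open>- ((a \<times> p) \<bullet> n)\<close>, its sign selecting the landing half of the
    circle. The formula pairs \<open>n \<times> b\<close> with the decomposition of
    \<open>A *\<^sub>R p\<close>.\<close>
  define q where "q x = x * D - sqrt (A - x\<^sup>2) * C" for x
  have q: "A * ((b \<times> p) \<bullet> n) = q (a \<bullet> p)"
    if p: "p \<in> S2" "n \<bullet> p = 0" "(a \<times> p) \<bullet> n < 0" for p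
  proof -
    have "a \<times> p = ((a \<times> p) \<bullet> n) *\<^sub>R n" by (rule horizontal_cross[OF n_n a_n p(2)])
    then have "norm (a \<times> p) = \<bar>(a \<times> p) \<bullet> n\<bar>" using norm_n by (metis mult.right_neutral norm_scaleR)
    then have "((a \<times> p) \<bullet> n)\<^sup>2 + (a \<bullet> p)\<^sup>2 = A"
      using norm_cross_dot[of a p] p(1) by (simp add: A_def power2_norm_eq_inner)
    then have s: "sqrt (A - (a \<bullet> p)\<^sup>2) = - ((a \<times> p) \<bullet> n)"
      using p(3) by (metis abs_of_neg add_diff_cancel_right' real_sqrt_abs)
    have nab: "(n \<times> b) \<bullet> (n \<times> a) = C"
      using n_n a_n b_n by (simp add: dot_cross C_def inner_commute)
    have "A * ((b \<times> p) \<bullet> n) = (n \<times> b) \<bullet> (A *\<^sub>R p)" by (simp add: e)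
    also have "\<dots> = (a \<bullet> p) * D + ((a \<times> p) \<bullet> n) * C"
      unfolding A_def horizontal_decomposition[OF n_n a_n p(2)] inner_add_right inner_scaleR_right nab
      by (simp add: D_def inner_commute)
    finally show ?thesis unfolding q_def s by simp
  qed
  have "open {x. 0 < q x}"
    unfolding q_def by (intro open_Collect_less continuous_intros)
  moreover have ex: "{x. 0 < q x} \<inter> closure {- sqrt A<..<sqrt A} \<noteq> {}"
  proof (cases "D = 0")
    \<comment> \<open>\<open>D = 0\<close> makes the axes parallel, so by assumption opposite; then
      \<open>C < 0\<close> and level 0 works.\<close>
    case True
    have "(b \<times> a) \<bullet> n = D" using e[of b a] by (simp add: D_def inner_commute)
    then have "(a \<times> b) \<bullet> n = 0" using True cross_skew[of a b] by simp
    then have "A *\<^sub>R b = C *\<^sub>R a"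
      using horizontal_decomposition[OF n_n a_n, of b] b_n by (simp add: A_def C_def inner_commute)
    then have "b = (C / A) *\<^sub>R a"
      using A by (metis divideR_right less_irrefl scaleR_scaleR divide_inverse_commute)
    then have "C \<noteq> 0" "\<not> C > 0" using assms[of "C / A"] A b_nz by auto
    then have "C < 0" by simp
    then have "0 < q 0" using A by (simp add: q_def mult_less_0_iff)
    then show ?thesis using A by force
  next
    case False
    \<comment> \<open>At the ends of the range the root vanishes, and the linear term is positive at
      the end with the sign of \<open>D\<close>.\<close>
    have "q (sgn D * sqrt A) = \<bar>D\<bar> * sqrt A"
      using A False by (simp add: q_def power_mult_distrib sgn_if)
    then have "0 < q (sgn D * sqrt A)" using A False by simp
    moreover have "sgn D * sqrt A \<in> {- sqrt A..sqrt A}" using A by (auto simp: sgn_if)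
    ultimately show ?thesis using A by auto
  qed
  \<comment> \<open>An open set that meets the closure of the interval meets the interval itself, so
    an end point suffices as witness.\<close>
  ultimately obtain x0 where x0: "0 < q x0" "x0 \<in> {- sqrt A<..<sqrt A}"
    using open_Int_closure_eq_empty[of "{x. 0 < q x}"] by blast
  have "open ({x. 0 < q x} \<inter> {- sqrt A<..<sqrt A})"
    using \<open>open {x. 0 < q x}\<close> by auto
  \<comment> \<open>A closed ball keeps the ends of the new interval strictly inside the
    range.\<close>
  then obtain d where d: "d > 0" "cball x0 d \<subseteq> {x. 0 < q x} \<inter> {- sqrt A<..<sqrt A}"
    using x0 by (metis (mono_tags, lifting) IntI mem_Collect_eq open_contains_cball)
  have sub: "{x0 - d..x0 + d} \<subseteq> {x. 0 < q x} \<inter> {- sqrt A<..<sqrt A}"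
    using d(2) by (simp add: cball_eq_atLeastAtMost)
  show ?thesis
  proof (rule that[of "x0 - d" "x0 + d"])
    show "x0 - d < x0 + d" using d by simp
    show "- norm a < x0 - d" "x0 + d < norm a" 
      using subsetD[OF sub, of "x0 - d"] subsetD[OF sub, of "x0 + d"] d(1) A(2) by auto
    fix p :: vec3
    assume p: "p \<in> S2" "n \<bullet> p = 0" "a \<bullet> p \<in> {x0 - d<..<x0 + d}" "(a \<times> p) \<bullet> n < 0"
    then have "0 < q (a \<bullet> p)" using subsetD[OF sub, of "a \<bullet> p"] by simp
    then have "0 < A * ((b \<times> p) \<bullet> n)" using q[OF p(1,2,4)] by simp
    then show "(b \<times> p) \<bullet> n > 0" using A by (simp add: zero_less_mult_iff)
  qed
qed

lemma ex_zone_pos_level: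
  assumes "- norm a < x" "x < norm a"
  shows "\<exists>p\<in>S2. n \<bullet> p > 0 \<and> a \<bullet> p = x"
proof -
  define y where "y = x / norm a"
  define e where "e = (1 / norm a) *\<^sub>R a"
  have y: "\<bar>y\<bar> < 1" using assms a_nz by (auto simp: y_def abs_less_iff field_simps)
  then have y2: "y\<^sup>2 < 1" by (simp add: abs_square_less_1)
  have e: "e \<bullet> e = 1" "n \<bullet> e = 0" "a \<bullet> e = norm a"
    using a_nz a_n by (simp_all add: e_def inner_commute dot_square_norm power2_eq_square)
  let ?p = "y *\<^sub>R e + sqrt (1 - y\<^sup>2) *\<^sub>R n"
  have "?p \<bullet> ?p = y\<^sup>2 + (sqrt (1 - y\<^sup>2))\<^sup>2"
    using e n_n by (simp add: inner_add inner_commute power2_eq_square)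
  then have "?p \<in> S2" using y2 by (simp add: norm_eq_1)
  moreover have "n \<bullet> ?p > 0" using e n_n y2 by (simp add: inner_add_right)
  moreover have "a \<bullet> ?p = x" using e a_n a_nz by (simp add: inner_add_right y_def)
  ultimately show ?thesis by blast
qed

lemma not_transitive: "\<not> topologically_transitive Z"
proof
  assume T: "topologically_transitive Z"
  have "b \<noteq> k *\<^sub>R a" if "k > 0" for k
    using not_transitive_if_same_direction that T by blast
  then obtain x y where xy: "x < y" "- norm a < x" "y < norm a"
    and land: "\<And>p. p \<in> S2 \<Longrightarrow> n \<bullet> p = 0 \<Longrightarrow> a \<bullet> p \<in> {x<..<y} \<Longrightarrow> (a \<times> p) \<bullet> n < 0 \<Longrightarrow> (b \<times> p) \<bullet> n > 0"
    using sliding_interval by blast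
  \<comment> \<open>Bands of the positive zone between two levels; the two halves of the interval of
    levels give the open sets that no trajectory joins.\<close>
  define W where "W l m = S2 \<inter> {p. n \<bullet> p > 0 \<and> l < a \<bullet> p \<and> a \<bullet> p < m}" for l m
  have W: "openin (top_of_set S2) (W l m)" for l m
    unfolding W_def by (intro openin_open_Int open_Collect_conj open_Collect_less continuous_intros)
  have W': "W l m \<noteq> {}" if "x \<le> l" "l < m" "m \<le> y" for l m
  proof -
    have "- norm a < (l + m) / 2" "(l + m) / 2 < norm a" using that xy by simp_all
    from ex_zone_pos_level[OF this] obtain p where "p \<in> S2" "n \<bullet> p > 0" "a \<bullet> p = (l + m) / 2"
      by blast
    then have "p \<in> W l m" using that unfolding W_def by simp
    then show ?thesis by blast
  qed
  define m where "m = (x + y) / 2"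
  have m: "x < m" "m < y" using xy by (simp_all add: m_def)
  obtain I \<phi> s t where "filippov_trajectory Z I \<phi>"
    and s: "s \<in> I" "\<phi> s \<in> W x m" and t: "t \<in> I" "\<phi> t \<in> W m y"
    using T[unfolded topologically_transitive_def, rule_format, of "W x m" "W m y"] W W' m
    by (metis order.refl less_imp_le)
  then have gt: "global_trajectory Z I \<phi>" unfolding filippov_trajectory_def by blast
  \<comment> \<open>From such a band a trajectory leaves the positive zone only by landing at
    sliding points, where it rests. So its level persists, forward in time.\<close>
  have const: "a \<bullet> \<phi> t' = a \<bullet> \<phi> s'"
    if I: "s' \<in> I" "t' \<in> I" "s' \<le> t'" and u: "n \<bullet> \<phi> s' > 0" "a \<bullet> \<phi> s' \<in> {x<..<y}" for s' t'
  proof -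
    let ?Q = "\<lambda>p. a \<bullet> p = a \<bullet> \<phi> s' \<and> (n \<bullet> p > 0 \<or> n \<bullet> p = 0 \<and> (a \<times> p) \<bullet> n < 0 \<and> (b \<times> p) \<bullet> n > 0)"
    have "?Q (\<phi> t')"
    proof (rule global_trajectory_induct[OF gt I, where Q = ?Q])
      show "?Q (\<phi> s')" using u by simp
      show "?Q (\<phi> v)" if "joint_free_arc Z u v \<phi>" "?Q (\<phi> u)" for u v
        using joint_free_arc_trapped[OF that(1), of "a \<bullet> \<phi> s'"] that(2) land u(2) by simp
    qed
    then show ?thesis by simp
  qed
  \<comment> \<open>Whichever visit comes first lies in a band, so forward invariance
    suffices.\<close>
  have "a \<bullet> \<phi> s = a \<bullet> \<phi> t"
    using const[OF s(1) t(1)] const[OF t(1) s(1)] s(2) t(2) m unfolding W_def by (cases "s \<le> t") auto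
  then show False using s t unfolding W_def by auto
qed

end

theorem proposition1:
  fixes r :: nat
  shows "\<not> (\<exists>Z :: psvf. is_psvf r Z \<and> is_circle (switching Z) \<and> piecewise_linear Z \<and>
             topologically_transitive Z)"
proof
  assume "\<exists>Z :: psvf. is_psvf r Z \<and> is_circle (switching Z) \<and> piecewise_linear Z \<and>
             topologically_transitive Z"
  then obtain Z where Z: "is_psvf r Z" "is_circle (switching Z)" "piecewise_linear Z"
    and T: "topologically_transitive Z" by blast
  obtain n a b c where "two_rotations Z r n a b c"
    using two_rotations_exist[OF Z] .
  then interpret two_rotations Z r n a b c .
  note h = transitive_imp_horizontal_axes[OF T]
  interpret horizontal_rotations Z r n a b
    using two_rotations_axioms h unfolding horizontal_rotations_def horizontal_rotations_axioms_def by simp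
  show False using not_transitive T by blast
qed

end
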